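(* Let $d\geqslant 4$ be an even integer and let $n$ be a positive integer with $n\equiv -1\pmod{d}$. Then \[ \sum_{k=0}^{n-1}[2dk+1]\frac{(q;q^d)_k^d}{(q^d;q^d)_k^d}q^{\frac{d(d-3)k}{2}} \equiv 0\pmod{\Phi_n(q)^2}. \]
   Context: $q$ is an indeterminate. The $q$-shifted factorial is $(a;q)_k=(1-a)(1-aq)\cdots(1-aq^{k-1})$ (with $(a;q)_0=1$). For any integer $m$, $[m]=(1-q^m)/(1-q)$. $\Phi_n(q)$ denotes the $n$-th cyclotomic polynomial. A congruence of rational functions modulo a polynomial $P(q)$, where the denominators are coprime to $P(q)$, means that $P(q)$ divides the numerator of the difference in lowest terms. *)

theory Defs
  imports Complex_Main
    "HOL-Computational_Algebra.Computational_Algebra"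
    "HOL-Computational_Algebra.Field_as_Ring"
    "HOL-Number_Theory.Cong"
begin

definition qpoch :: "'a::comm_ring_1 \<Rightarrow> 'a \<Rightarrow> nat \<Rightarrow> 'a" where
  "qpoch a q k = (\<Prod>j<k. (1 - a * q ^ j))"

definition qvar :: "rat poly fract" where
  "qvar = to_fract [:0, 1:]"

definition qint :: "nat \<Rightarrow> rat poly fract" where
  "qint m = (1 - qvar ^ m) / (1 - qvar)"

definition cyclotomic :: "nat \<Rightarrow> complex poly" where
  "cyclotomic n = (\<Prod>k\<in>{k. k < n \<and> coprime k n}. [:- cis (2 * pi * real k / real n), 1:])"

(* congruence x == 0 modulo P for a rational function x: writing x = a/b in lowest terms,
   b is coprime to P and P divides a *)
definition ratfun_cong_zero :: "rat poly fract \<Rightarrow> complex poly \<Rightarrow> bool" where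
  "ratfun_cong_zero x P = (case quot_of_fract x of (a, b) \<Rightarrow>
      coprime (map_poly of_rat b) P \<and> P dvd map_poly of_rat a)"

end

theory Submission
  imports Defs
begin

text \<open>
  Put \<open>p = q\<^sup>d\<close>, \<open>d = 2M + 2\<close>, \<open>n + 1 = d (m + 1)\<close> and \<open>N = n - m - 1\<close>, so that \<open>q p\<^sup>N\<close> is \<open>q\<close> to the power
  \<open>(d - 1) n\<close>.
  All terms with \<open>k > N\<close> are divisible by the \<open>d\<close>-th power of the cyclotomic polynomial. The remaining
  well-poised sum has \<open>d - 1\<close> numerator parameters equal to \<open>q\<close> besides the leading one; deform
  one of them to \<open>q\<close> divided by \<open>x\<close> to the power \<open>d - 1\<close>, and \<open>M\<close> of them to \<open>q x\<close>.

  If \<open>q = \<zeta>\<close> is a primitive \<open>n\<close>-th root of unity, the reversal \<open>k \<mapsto> N - k\<close> shows that the deformed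
  sum vanishes for all \<open>x\<close>, hence as a polynomial in \<open>q\<close> and \<open>x\<close> it is divisible by \<open>q - \<zeta>\<close>.
  If \<open>x = q\<^sup>n\<close>, the sum terminates naturally, and it becomes a divided difference at the \<open>N + 1\<close> nodes
  \<open>1 / p\<^sup>k + q p\<^sup>k\<close> of a polynomial of degree \<open>M m < N\<close>, hence vanishes. So its quotient by
  \<open>q - \<zeta>\<close> vanishes at \<open>x = q\<^sup>n\<close>, in particular at \<open>(q, x) = (\<zeta>, 1)\<close>, which makes the undeformed sum
  divisible by the square of \<open>q - \<zeta>\<close>.
\<close>

section \<open>Divided differences through Lagrange interpolation\<close>

text \<open>Up to the factor \<open>C\<close>, the weights are the Lagrange weights, so the sum is
  \<open>C\<close> times the divided difference of \<open>f\<close>: the coefficient of degree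
  \<open>N\<close> in the polynomial that interpolates \<open>C f\<close>.\<close>

lemma lagrange_weights_sum_eq_0:
  fixes u W :: "nat \<Rightarrow> 'a::field" and f :: "'a poly"
  assumes inj: "inj_on u {..N}" and deg: "degree f < N"
    and W: "\<And>k. k \<le> N \<Longrightarrow> W k * (\<Prod>j\<in>{..N} - {k}. u k - u j) = C"
  shows "(\<Sum>k\<le>N. W k * poly f (u k)) = 0"
proof -
  define l where "l k = (\<Prod>j\<in>{..N} - {k}. [:- u j, 1:])" for k
  \<comment> \<open>The interpolant of \<open>C f\<close> minus \<open>C f\<close> itself:
    \<open>N + 1\<close> roots against degree at most \<open>N\<close>.\<close>
  define L where "L = (\<Sum>k\<le>N. smult (W k * poly f (u k)) (l k)) - smult C f"
  have deg_l: "degree (l k) = N" and lead_l: "coeff (l k) N = 1" if "k \<le> N" for k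
  proof -
    show "degree (l k) = N"
      using that unfolding l_def by (subst degree_prod_sum_eq) auto
    moreover have "lead_coeff (l k) = 1"
      unfolding l_def lead_coeff_prod by simp
    ultimately show "coeff (l k) N = 1" by simp
  qed
  have "poly L (u i) = 0" if "i \<le> N" for i
  proof -
    have l0: "poly (l k) (u i) = 0" if "k \<le> N" "k \<noteq> i" for k
      using that \<open>i \<le> N\<close> by (auto simp: l_def poly_prod intro!: prod_zero)
    have "(\<Sum>k\<le>N. W k * poly f (u k) * poly (l k) (u i)) = (\<Sum>k\<in>{i}. W k * poly f (u k) * poly (l k) (u i))"
      by (rule sum.mono_neutral_right) (use that l0 in auto)
    also have "\<dots> = C * poly f (u i)"
      using W[OF that] by (simp add: l_def poly_prod algebra_simps)
    finally show ?thesis by (simp add: L_def poly_sum)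
  qed
  hence sub: "u ` {..N} \<subseteq> {x. poly L x = 0}" by auto
  have degL: "degree L \<le> N"
    unfolding L_def using deg deg_l
    by (intro degree_diff_le degree_sum_le) (auto intro: order.trans[OF degree_smult_le])
  have "L = 0"
  proof (rule ccontr)
    assume "L \<noteq> 0"
    have "card (u ` {..N}) \<le> degree L"
      using card_mono[OF poly_roots_finite[OF \<open>L \<noteq> 0\<close>] sub] card_poly_roots_bound[OF \<open>L \<noteq> 0\<close>] by simp
    with degL show False using card_image[OF inj] by simp
  qed
  hence "coeff L N = 0" by simp
  thus ?thesis using deg by (simp add: L_def coeff_sum lead_l coeff_eq_0)
qed

section \<open>The deformed well-poised sum\<close>

text \<open>
  The factor of a well-poised summand coming from the numerator parameter \<open>q y / x\<close>, with
  its denominator cleared up to \<open>N\<close> and homogenised in \<open>x\<close>, \<open>y\<close>.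
\<close>

definition wpoly :: "nat \<Rightarrow> 'a::comm_ring_1 \<Rightarrow> 'a \<Rightarrow> 'a \<Rightarrow> 'a \<Rightarrow> nat \<Rightarrow> 'a" where
  "wpoly N q p x y k = (\<Prod>j<k. x - q * y * p ^ j) * (\<Prod>j=k..<N. y - x * p ^ Suc j)"

text \<open>At \<open>x = 1\<close> the \<open>2 * M + 2\<close> factors give the
  \<open>d\<close>-th power of the original quotient, denominators cleared. The homogenisation in
  \<open>wpoly\<close> supplies the power of \<open>x\<close> that depends on \<open>k\<close>, and
  \<open>(M + 1) * (2 * M - 1)\<close> is \<open>d (d - 3) / 2\<close>.\<close>

definition defsum :: "nat \<Rightarrow> nat \<Rightarrow> 'a::comm_ring_1 \<Rightarrow> 'a \<Rightarrow> 'a" where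
  "defsum M N q x = (let p = q ^ (2 * M + 2) in
     \<Sum>k\<le>N. (1 - q * p ^ (2 * k)) * wpoly N q p 1 1 k ^ (M + 1) * wpoly N q p (x ^ (2 * M + 1)) 1 k
       * wpoly N q p 1 x k ^ M * q ^ ((M + 1) * (2 * M - 1) * k))"

section \<open>Reversal of the sum at a root of unity\<close>

text \<open>Reversing the index exchanges the two products: since \<open>q * p ^ N = 1\<close>, the
  factor \<open>x - q * y * p ^ (N - Suc j)\<close> times \<open>p ^ Suc j\<close> is
  \<open>-(y - x * p ^ Suc j)\<close>, and similarly for the other product. The extra product on the
  left clears these powers without division.\<close>

lemma wpoly_reflect:
  fixes q p :: "'a::comm_ring_1"
  assumes qp: "q * p ^ N = 1" and k: "k \<le> N"
  shows "wpoly N q p x y (N - k) * ((\<Prod>j<k. q * p ^ j) * (\<Prod>j=k..<N. p ^ Suc j))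
    = (-1) ^ N * wpoly N q p x y k"
proof -
  have 1: "(\<Prod>j<N - k. x - q * y * p ^ j) = (\<Prod>j=k..<N. x - q * y * p ^ (N - Suc j))"
    by (rule prod.reindex_bij_witness[of _ "\<lambda>j. N - Suc j" "\<lambda>j. N - Suc j"]) (use k in auto)
  have 2: "(\<Prod>j=N - k..<N. y - x * p ^ Suc j) = (\<Prod>j<k. y - x * p ^ (N - j))"
    by (rule prod.reindex_bij_witness[of _ "\<lambda>j. N - Suc j" "\<lambda>j. N - Suc j"])
       (use k in \<open>auto simp: Suc_diff_Suc simp flip: power_Suc\<close>)
  have 3: "(\<Prod>j=k..<N. x - q * y * p ^ (N - Suc j)) * (\<Prod>j=k..<N. p ^ Suc j)
      = (-1) ^ (N - k) * (\<Prod>j=k..<N. y - x * p ^ Suc j)"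
  proof -
    have "(\<Prod>j=k..<N. x - q * y * p ^ (N - Suc j)) * (\<Prod>j=k..<N. p ^ Suc j)
       = (\<Prod>j=k..<N. - 1 * (y - x * p ^ Suc j))"
      unfolding prod.distrib[symmetric]
    proof (rule prod.cong)
      fix j assume j: "j \<in> {k..<N}"
      have "p ^ (N - Suc j) * p ^ Suc j = p ^ N" using j by (simp flip: power_add del: power_Suc)
      hence "q * y * p ^ (N - Suc j) * p ^ Suc j = y * (q * p ^ N)" by (simp only: mult_ac)
      thus "(x - q * y * p ^ (N - Suc j)) * p ^ Suc j = - 1 * (y - x * p ^ Suc j)"
        using qp by (simp add: left_diff_distrib)
    qed simp
    also have "\<dots> = (-1) ^ (N - k) * (\<Prod>j=k..<N. y - x * p ^ Suc j)"
      by (subst prod.distrib) simp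
    finally show ?thesis .
  qed
  have 4: "(\<Prod>j<k. y - x * p ^ (N - j)) * (\<Prod>j<k. q * p ^ j) = (-1) ^ k * (\<Prod>j<k. x - q * y * p ^ j)"
  proof -
    have "(\<Prod>j<k. y - x * p ^ (N - j)) * (\<Prod>j<k. q * p ^ j) = (\<Prod>j<k. - 1 * (x - q * y * p ^ j))"
      unfolding prod.distrib[symmetric]
    proof (rule prod.cong)
      fix j assume j: "j \<in> {..<k}"
      have "p ^ (N - j) * p ^ j = p ^ N" using j k by (simp flip: power_add)
      hence "x * p ^ (N - j) * (q * p ^ j) = x * (q * p ^ N)" by (simp only: mult_ac)
      thus "(y - x * p ^ (N - j)) * (q * p ^ j) = - 1 * (x - q * y * p ^ j)"
        using qp by (simp add: algebra_simps)
    qed simp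
    also have "\<dots> = (-1) ^ k * (\<Prod>j<k. x - q * y * p ^ j)"
      by (subst prod.distrib) simp
    finally show ?thesis .
  qed
  have "wpoly N q p x y (N - k) * ((\<Prod>j<k. q * p ^ j) * (\<Prod>j=k..<N. p ^ Suc j))
     = ((\<Prod>j=k..<N. x - q * y * p ^ (N - Suc j)) * (\<Prod>j=k..<N. p ^ Suc j)) *
       ((\<Prod>j<k. y - x * p ^ (N - j)) * (\<Prod>j<k. q * p ^ j))"
    unfolding wpoly_def 1 2 by (simp only: mult_ac)
  also have "\<dots> = ((-1) ^ (N - k) * (-1) ^ k) * wpoly N q p x y k"
    unfolding 3 4 wpoly_def by (simp only: mult_ac)
  also have "(-1) ^ (N - k) * (-1) ^ k = ((-1) ^ N :: 'a)"
    using k by (simp flip: power_add)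
  finally show ?thesis .
qed

text \<open>Evaluates the clearing product of the reversal for \<open>p = q ^ d\<close>. The
  exponent is \<open>k - d k + d N (N + 1) / 2\<close>, stated doubled and without subtraction to
  stay in the naturals.\<close>

lemma reflect_factor:
  fixes q :: "'a::comm_ring_1"
  assumes "k \<le> N"
  obtains e where "(\<Prod>j<k. q * (q ^ d) ^ j) * (\<Prod>j=k..<N. (q ^ d) ^ Suc j) = q ^ e"
    "2 * e + 2 * d * k = 2 * k + d * (N * Suc N)"
proof -
  define e where "e = (\<Sum>j<k. 1 + d * j) + (\<Sum>j=k..<N. d * Suc j)"
  have "(\<Prod>j<k. q * (q ^ d) ^ j) * (\<Prod>j=k..<N. (q ^ d) ^ Suc j) = q ^ e"
    by (simp add: e_def power_add power_sum power_mult prod.distrib)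
  moreover have "2 * e + 2 * d * k = 2 * k + d * (N * Suc N)"
    using assms unfolding e_def
  proof (induction k)
    case 0
    have "2 * (\<Sum>j<N. d * Suc j) = d * (N * Suc N)"
      by (induction N) (auto simp: algebra_simps)
    thus ?case by (simp add: atLeast0LessThan)
  next
    case (Suc k)
    thus ?case by (simp add: sum.atLeast_Suc_lessThan algebra_simps)
  qed
  ultimately show ?thesis using that by blast
qed

text \<open>The terms at \<open>k\<close> and \<open>N - k\<close> are opposite, so the sum equals
  its own negative, which forces 0 in characteristic 0.\<close>

lemma defsum_eq_0_at_root:
  fixes q x :: "'a::field_char_0"
  assumes root: "q ^ ((2 * M + 2) * N + 1) = 1" and M: "M \<ge> 1"
  shows "defsum M N q x = 0"
proof -
  define d where "d = 2 * M + 2"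
  define p where "p = q ^ d"
  define z where "z = (M + 1) * (2 * M - 1)"
  define \<omega> where "\<omega> k = wpoly N q p 1 1 k ^ (M + 1) * wpoly N q p (x ^ (2 * M + 1)) 1 k * wpoly N q p 1 x k ^ M" for k
  define T where "T k = (1 - q * p ^ (2 * k)) * \<omega> k * q ^ (z * k)" for k
  have E: "defsum M N q x = (\<Sum>k\<le>N. T k)"
    by (simp add: defsum_def T_def \<omega>_def z_def p_def d_def Let_def mult_ac)
  have qp: "q * p ^ N = 1"
    using root by (metis p_def d_def power_mult Suc_eq_plus1 power_Suc)
  have q0: "q \<noteq> 0" using qp by auto
  have T: "T (N - k) = - T k" if k: "k \<le> N" for k
  proof -
    obtain e where e: "(\<Prod>j<k. q * p ^ j) * (\<Prod>j=k..<N. p ^ Suc j) = q ^ e"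
      "2 * e + 2 * d * k = 2 * k + d * (N * Suc N)"
      unfolding p_def using reflect_factor[OF k] by blast
    have w: "wpoly N q p x y (N - k) * q ^ e = (-1) ^ N * wpoly N q p x y k" for x y
      using wpoly_reflect[OF qp k, of x y] e(1) by simp
    have pow: "q ^ (d * e) = (q ^ e) ^ (M + 1) * q ^ e * (q ^ e) ^ M"
    proof -
      have "d * e = e * (M + 1) + e + e * M" by (simp add: d_def algebra_simps)
      thus ?thesis by (simp only: power_add power_mult)
    qed
    have "\<omega> (N - k) * q ^ (d * e) = (wpoly N q p 1 1 (N - k) * q ^ e) ^ (M + 1)
        * (wpoly N q p (x ^ (2 * M + 1)) 1 (N - k) * q ^ e) * (wpoly N q p 1 x (N - k) * q ^ e) ^ M"
      unfolding \<omega>_def pow by (simp only: power_mult_distrib mult_ac)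
    also have "\<dots> = ((-1) ^ N) ^ (M + 1) * (-1) ^ N * ((-1) ^ N) ^ M * \<omega> k"
      unfolding w \<omega>_def by (simp only: power_mult_distrib mult_ac)
    \<comment> \<open>One sign from each of the \<open>2 * M + 2\<close> factors, an even
      number.\<close>
    also have "((-1) ^ N) ^ (M + 1) * (-1) ^ N * ((-1) ^ N) ^ M = (1::'a)"
      by (cases "even N") (auto simp: mult_ac)
    finally have \<omega>: "\<omega> (N - k) * q ^ (d * e) = \<omega> k" by simp
    \<comment> \<open>The exponent on the left exceeds \<open>z * (N - k)\<close> by a multiple of
      \<open>d * N + 1\<close>, and \<open>q ^ (d * N + 1) = 1\<close>.\<close>
    have ex: "1 + 2 * d * k + z * k + d * e = z * (N - k) + (d * N + 1) * ((M + 1) * N + 1)"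
    proof -
      obtain j where j: "N = k + j" using k le_Suc_ex by blast
      obtain M' where M': "M = Suc M'" using M by (cases M) auto
      have e2: "int e = int k + (M' + 2) * (N * (int N + 1)) - d * int k"
      proof -
        have "2 * int e + 2 * d * k = 2 * int k + d * (N * (int N + 1))"
          using arg_cong[OF e(2), of int] by (simp add: algebra_simps)
        thus ?thesis by (simp add: d_def M' algebra_simps)
      qed
      have "int (1 + 2 * d * k + z * k + d * e) = int (z * (N - k) + (d * N + 1) * ((M + 1) * N + 1))"
        unfolding of_nat_add of_nat_mult e2
        by (simp add: j d_def M' z_def algebra_simps)
      thus ?thesis by linarith
    qed
    have "q ^ ((d * N + 1) * ((M + 1) * N + 1)) = 1"
      using root by (simp only: d_def power_mult power_one)
    hence zz: "q ^ (z * (N - k)) = q ^ (1 + 2 * d * k + z * k + d * e)"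
      unfolding ex power_add[of _ "z * (N - k)"] by simp
    \<comment> \<open>Both sides are 1, so \<open>q * p ^ (2 * k)\<close> is inverse to its
      counterpart at \<open>N - k\<close>; this produces the minus sign in \<open>T\<close>.\<close>
    have "(q * p ^ (2 * (N - k))) * (q * p ^ (2 * k)) = (q * p ^ N) * (q * p ^ N)"
    proof -
      have "p ^ (2 * (N - k)) * p ^ (2 * k) = p ^ N * p ^ N"
        using k by (simp only: power_add[symmetric] mult_2[symmetric] add_mult_distrib2[symmetric] le_add_diff_inverse2)
      moreover have "(q * a) * (q * b) = (q * c) * (q * c)" if "a * b = c * c" for a b c
      proof -
        have "(q * a) * (q * b) = q * q * (a * b)" by (simp only: mult_ac)
        thus ?thesis unfolding that by (simp only: mult_ac)
      qed
      ultimately show ?thesis by blast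
    qed
    hence a: "(1 - q * p ^ (2 * (N - k))) * (q * p ^ (2 * k)) = - (1 - q * p ^ (2 * k))"
      using qp by (simp add: left_diff_distrib)
    have b: "q ^ (1 + 2 * d * k) = q * p ^ (2 * k)"
      by (simp add: p_def mult_ac flip: power_mult)
    have "T (N - k) = ((1 - q * p ^ (2 * (N - k))) * (q * p ^ (2 * k))) * (\<omega> (N - k) * q ^ (d * e)) * q ^ (z * k)"
      unfolding T_def zz power_add[of _ "1 + 2 * d * k + z * k"] power_add[of _ "1 + 2 * d * k"] b
      by (simp only: mult_ac)
    also have "\<dots> = - T k" unfolding a \<omega> T_def by (simp only: mult_minus_left)
    finally show ?thesis .
  qed
  have "(\<Sum>k\<le>N. T k) = (\<Sum>k\<le>N. T (N - k))"
    using sum.nat_diff_reindex[of T "Suc N"] by (simp add: lessThan_Suc_atMost)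
  also have "\<dots> = - (\<Sum>k\<le>N. T k)"
    unfolding sum_negf[symmetric] by (rule sum.cong) (auto simp: T)
  finally show ?thesis unfolding E by (simp add: eq_neg_iff_add_eq_0)
qed

section \<open>The naturally terminating case as a divided difference\<close>

text \<open>The function 1 / t + q t takes equal values at t and 1 / (q t), so a difference of two
  of its values has two linear factors.\<close>

lemma node_diff:
  fixes q p :: "'a::field"
  assumes p: "p \<noteq> 0" and "j \<le> i"
  shows "(1 / p ^ i + q * p ^ i) - (1 / p ^ j + q * p ^ j)
    = (1 - p ^ (i - j)) * (1 - q * p ^ (i + j)) / p ^ i"
proof -
  obtain l where l: "i = j + l" using assms(2) le_Suc_ex by blast
  have "1 / (a * b) + q * (a * b) - (1 / a + q * a) = (1 - b) * (1 - q * (a * b * a)) / (a * b)"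
    if "a \<noteq> 0" "b \<noteq> 0" for a b
    using that by (simp add: field_simps)
  from this[of "p ^ j" "p ^ l"] show ?thesis using p by (simp add: l power_add)
qed

text \<open>Identifies the Lagrange weights: when the deformed parameter is
  \<open>1 / p ^ N\<close>, the linear factor, one undeformed factor and the deformed factor are
  together, up to \<open>q ^ k\<close> and a constant, inverse to the product of node
  differences.\<close>

lemma node_prod_const:
  fixes q p :: "'a::field"
  assumes p: "p \<noteq> 0" and k: "k \<le> N"
  defines "u \<equiv> \<lambda>k. 1 / p ^ k + q * p ^ k"
  shows "(1 - q * p ^ (2 * k)) * wpoly N q p 1 1 k * wpoly N q p (q * p ^ N) 1 k
    * (\<Prod>j\<in>{..N} - {k}. u k - u j)
    = (-1) ^ N * (\<Prod>j<N. 1 - p ^ Suc j) ^ 2 * (\<Prod>j<2 * N + 1. 1 - q * p ^ j)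
        / (\<Prod>j<N. p ^ Suc j) * q ^ k"
proof -
  \<comment> \<open>The number of nodes after \<open>k\<close>, not the \<open>n\<close> of the
    theorem.\<close>
  define n where "n = N - k"
  have N: "N = k + n" using k by (simp add: n_def)
  define Q where "Q l = (\<Prod>j<l. 1 - p ^ Suc j)" for l
  define R where "R l = (\<Prod>j<l. 1 - q * p ^ j)" for l
  have shift: "(\<Prod>j=k..<N. f j) = (\<Prod>j<n. f (k + j))" for f :: "nat \<Rightarrow> 'a"
    by (rule prod.reindex_bij_witness[of _ "\<lambda>j. k + j" "\<lambda>j. j - k"]) (auto simp: N)
  have split: "(\<Prod>j\<in>{..N} - {k}. f j) = (\<Prod>j<k. f j) * (\<Prod>j<n. f (k + Suc j))" for f :: "nat \<Rightarrow> 'a"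
  proof -
    have sp: "prod f ({..<k} \<union> {Suc k..<Suc N}) = prod f {..<k} * prod f {Suc k..<Suc N}"
      by (rule prod.union_disjoint) auto
    have "{..N} - {k} = {..<k} \<union> {Suc k..<Suc N}" by (auto simp: N)
    hence "(\<Prod>j\<in>{..N} - {k}. f j) = (\<Prod>j<k. f j) * (\<Prod>j=Suc k..<Suc N. f j)"
      by (metis sp)
    also have "(\<Prod>j=Suc k..<Suc N. f j) = (\<Prod>j<n. f (k + Suc j))"
      by (simp only: prod.shift_bounds_Suc_ivl shift add_Suc_right)
    finally show ?thesis .
  qed
  have rev: "(\<Prod>j<l. f (l - j)) = (\<Prod>j<l. f (Suc j))" for f :: "nat \<Rightarrow> 'a" and l
    by (rule prod.reindex_bij_witness[of _ "\<lambda>j. l - Suc j" "\<lambda>j. l - Suc j"]) (auto simp: Suc_diff_Suc)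
  have app: "(\<Prod>j<a + b. f j) = (\<Prod>j<a. f j) * (\<Prod>j<b. f (a + j))" for f :: "nat \<Rightarrow> 'a" and a b
    by (induction b) (auto simp: mult_ac)
  have du: "u i - u j = (1 - p ^ (i - j)) * (1 - q * p ^ (i + j)) / p ^ i" if "j \<le> i" for i j
    unfolding u_def by (rule node_diff[OF p that])
  have U: "(\<Prod>j\<in>{..N} - {k}. u k - u j) =
      Q k * (\<Prod>j<k. 1 - q * p ^ (k + j)) / (\<Prod>j<k. p ^ k)
      * ((-1) ^ n * Q n * (\<Prod>j<n. 1 - q * p ^ (2 * k + Suc j)) / (\<Prod>j<n. p ^ (k + Suc j)))"
  proof -
    have "(\<Prod>j<k. u k - u j) = (\<Prod>j<k. (1 - p ^ (k - j)) * (1 - q * p ^ (k + j)) / p ^ k)"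
      by (rule prod.cong) (auto simp: du)
    also have "\<dots> = Q k * (\<Prod>j<k. 1 - q * p ^ (k + j)) / (\<Prod>j<k. p ^ k)"
      by (simp only: prod_dividef prod.distrib rev[of "\<lambda>j. 1 - p ^ j"] Q_def)
    finally have 1: "(\<Prod>j<k. u k - u j) = \<dots>" .
    have "(\<Prod>j<n. u k - u (k + Suc j)) = (\<Prod>j<n. - 1 * ((1 - p ^ Suc j) * (1 - q * p ^ (2 * k + Suc j)) / p ^ (k + Suc j)))"
    proof (rule prod.cong)
      fix j
      have e: "k + Suc j - k = Suc j" "k + Suc j + k = 2 * k + Suc j" by auto
      have "u k - u (k + Suc j) = - 1 * (u (k + Suc j) - u k)" by simp
      also have "u (k + Suc j) - u k = (1 - p ^ Suc j) * (1 - q * p ^ (2 * k + Suc j)) / p ^ (k + Suc j)"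
        by (subst du) (simp_all only: e le_add1)
      finally show "u k - u (k + Suc j) = - 1 * ((1 - p ^ Suc j) * (1 - q * p ^ (2 * k + Suc j)) / p ^ (k + Suc j))" .
    qed simp
    also have "\<dots> = (-1) ^ n * (Q n * (\<Prod>j<n. 1 - q * p ^ (2 * k + Suc j)) / (\<Prod>j<n. p ^ (k + Suc j)))"
      unfolding prod.distrib prod_dividef Q_def by simp
    finally show ?thesis unfolding split 1 by simp
  qed
  have w1: "wpoly N q p 1 1 k = R k * (\<Prod>j<n. 1 - p ^ Suc (k + j))"
    unfolding wpoly_def shift R_def by simp
  have QN: "Q N = Q k * (\<Prod>j<n. 1 - p ^ Suc (k + j))"
    unfolding Q_def N app ..
  have QN': "Q N = Q n * (\<Prod>j<k. 1 - p ^ (N - j))"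
  proof -
    have "(\<Prod>j<N. 1 - p ^ (N - j)) = (\<Prod>j<k. 1 - p ^ (N - j)) * (\<Prod>j<n. 1 - p ^ (n - j))"
      by (subst N, subst app) (simp add: N)
    thus ?thesis unfolding rev[of "\<lambda>j. 1 - p ^ j"] Q_def by (simp only: mult_ac)
  qed
  have w2: "wpoly N q p (q * p ^ N) 1 k = (-1) ^ k * q ^ k * (\<Prod>j<k. p ^ j) * (\<Prod>j<k. 1 - p ^ (N - j))
      * (\<Prod>j<n. 1 - q * p ^ (N + Suc (k + j)))"
  proof -
    have "(\<Prod>j<k. q * p ^ N - q * 1 * p ^ j) = (\<Prod>j<k. - 1 * q * p ^ j * (1 - p ^ (N - j)))"
    proof (rule prod.cong)
      fix j assume "j \<in> {..<k}"
      hence "p ^ j * p ^ (N - j) = p ^ N" using k by (simp flip: power_add)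
      thus "q * p ^ N - q * 1 * p ^ j = - 1 * q * p ^ j * (1 - p ^ (N - j))"
        by (simp add: right_diff_distrib mult.assoc)
    qed simp
    also have "\<dots> = (-1) ^ k * q ^ k * (\<Prod>j<k. p ^ j) * (\<Prod>j<k. 1 - p ^ (N - j))"
      unfolding prod.distrib by simp
    finally show ?thesis
      unfolding wpoly_def shift by (simp only: power_add mult.assoc)
  qed
  \<comment> \<open>The factors \<open>1 - q * p ^ j\<close> tile the range
    \<open>j \<le> 2 * N\<close>: \<open>w1\<close> gives \<open>j < k\<close>, the linear factor
    gives \<open>j = 2 * k\<close>, the node differences give the other \<open>j\<close> from
    \<open>k\<close> to \<open>N + k\<close>, and \<open>w2\<close> gives the rest.\<close>
  have R: "R (2 * N + 1) = R k * (\<Prod>j<k. 1 - q * p ^ (k + j)) * (1 - q * p ^ (2 * k))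
      * (\<Prod>j<n. 1 - q * p ^ (2 * k + Suc j)) * (\<Prod>j<n. 1 - q * p ^ (N + Suc (k + j)))"
  proof -
    have e: "2 * N + 1 = k + k + 1 + n + n" by (simp add: N)
    show ?thesis unfolding R_def e app
      by (simp add: N mult_2 add_ac)
  qed
  have P: "(\<Prod>j<k. p ^ k) * (\<Prod>j<n. p ^ (k + Suc j)) = (\<Prod>j<N. p ^ Suc j) * (\<Prod>j<k. p ^ j)"
  proof -
    have "(\<Prod>j<k. p ^ k) = (\<Prod>j<k. p ^ (k - j) * p ^ j)"
      by (rule prod.cong) (auto simp flip: power_add)
    also have "\<dots> = (\<Prod>j<k. p ^ Suc j) * (\<Prod>j<k. p ^ j)"
      unfolding prod.distrib rev[of "\<lambda>j. p ^ j"] ..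
    finally show ?thesis unfolding N app by (simp only: add_Suc_right mult_ac)
  qed
  have sgn: "(-1) ^ N = (-1) ^ n * (-1) ^ k * (1::'a)"
    by (simp add: N power_add)
  have nz: "(\<Prod>j<k. p ^ k) \<noteq> 0" "(\<Prod>j<n. p ^ (k + Suc j)) \<noteq> 0" "(\<Prod>j<N. p ^ Suc j) \<noteq> 0"
    using p by (auto simp: prod_zero_iff)
  have "(1 - q * p ^ (2 * k)) * wpoly N q p 1 1 k * wpoly N q p (q * p ^ N) 1 k
    * (\<Prod>j\<in>{..N} - {k}. u k - u j)
   = ((-1) ^ n * (-1) ^ k * 1) * (Q k * (\<Prod>j<n. 1 - p ^ Suc (k + j))) * (Q n * (\<Prod>j<k. 1 - p ^ (N - j)))
     * R (2 * N + 1) * q ^ k * (\<Prod>j<k. p ^ j) / ((\<Prod>j<k. p ^ k) * (\<Prod>j<n. p ^ (k + Suc j)))"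
    unfolding U w1 w2 R
    by (simp only: times_divide_eq_left times_divide_eq_right divide_divide_eq_left mult_ac mult_1_right mult_1_left)
  also have "\<dots> = (-1) ^ N * Q N ^ 2 * R (2 * N + 1) / (\<Prod>j<N. p ^ Suc j) * q ^ k"
    unfolding QN[symmetric] QN'[symmetric] sgn[symmetric] P
    using nz p by (simp add: power2_eq_square prod_zero_iff)
  finally show ?thesis unfolding Q_def R_def .
qed

text \<open>With \<open>q * x = p ^ Suc m\<close> the ratios of consecutive terms telescope, leaving
  \<open>2 * m\<close> factors that depend on \<open>k\<close>. These combine in pairs into linear
  factors in the node, whose roots are the values of \<open>u\<close> continued to the indices -1,
  ..., -m.\<close>

lemma wpoly_pair_eq:
  fixes q p x :: "'a::field"
  assumes p: "p \<noteq> 0" and x: "q * x = p ^ Suc m" "x \<noteq> 0"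
    and p1: "\<And>i. i > 0 \<Longrightarrow> p ^ i \<noteq> 1" and qp: "\<And>i j. q * p ^ i \<noteq> p ^ j"
  defines "u \<equiv> \<lambda>k. 1 / p ^ k + q * p ^ k"
  obtains C where "\<And>k. k \<le> N \<Longrightarrow> wpoly N q p 1 1 k * wpoly N q p 1 x k
    = C * (q / p) ^ k * (\<Prod>i<m. u k - (p ^ Suc i + q / p ^ Suc i))"
proof -
  define V where "V k = wpoly N q p 1 1 k * wpoly N q p 1 x k" for k
  define R1 where "R1 k = (\<Prod>i<m. 1 - p ^ (k + Suc i))" for k
  define R2 where "R2 k = (\<Prod>i<m. 1 - q * p ^ k / p ^ Suc i)" for k
  have q0: "q \<noteq> 0" using x p by (metis mult_zero_left power_not_zero)
  have R1: "R1 (Suc k) * (1 - p ^ Suc k) = R1 k * (1 - p ^ (k + Suc m))" for k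
    unfolding R1_def by (induction m) (auto simp: mult_ac)
  have R2: "R2 (Suc k) * (1 - q * p ^ k / p ^ m) = R2 k * (1 - q * p ^ k)" for k
    unfolding R2_def using p by (induction m) (auto simp: mult_ac)
  have V: "V (Suc k) * ((1 - p ^ Suc k) * (x - p ^ Suc k)) = V k * ((1 - q * p ^ k) * (1 - p ^ (k + Suc m)))"
    if "k < N" for k
  proof -
    have "q * x * p ^ k = p ^ (k + Suc m)" unfolding x by (simp add: power_add)
    thus ?thesis
      using that unfolding V_def wpoly_def
      by (simp add: prod.atLeast_Suc_lessThan[of k N] mult_ac)
  qed
  have xk: "x - p ^ Suc k = x * (1 - q * p ^ k / p ^ m)" for k
  proof -
    have "x = p ^ Suc m / q" using x q0 by (simp add: field_simps)
    thus ?thesis using q0 p by (simp add: field_simps)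
  qed
  have nz: "1 - p ^ Suc k \<noteq> 0" "1 - q * p ^ k / p ^ i \<noteq> 0" for k i
    using p1[of "Suc k"] qp[of k i] p by (auto simp: field_simps)
  have R0: "R1 0 \<noteq> 0" "R2 0 \<noteq> 0"
    unfolding R1_def R2_def using nz(1) nz(2)[of 0] by (auto simp: prod_zero_iff simp del: power_Suc)
  \<comment> \<open>Both sides satisfy the same first-order recurrence in \<open>k\<close>;
    \<open>x ^ k\<close> absorbs the factor \<open>x\<close> from \<open>xk\<close>.\<close>
  have main: "V k * x ^ k * (R1 0 * R2 0) = V 0 * (R1 k * R2 k)" if "k \<le> N" for k
    using that
  proof (induction k)
    case (Suc k)
    let ?a = "1 - p ^ Suc k" and ?b = "1 - q * p ^ k / p ^ m"
    have "V (Suc k) * x ^ Suc k * (R1 0 * R2 0) * (?a * ?b)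
        = (V (Suc k) * (?a * (x * ?b))) * (x ^ k * (R1 0 * R2 0))"
      by (simp add: mult_ac)
    also have "\<dots> = (V k * x ^ k * (R1 0 * R2 0)) * ((1 - q * p ^ k) * (1 - p ^ (k + Suc m)))"
      using V[of k] Suc.prems unfolding xk by (simp add: mult_ac)
    also have "\<dots> = V 0 * (R1 k * (1 - p ^ (k + Suc m))) * (R2 k * (1 - q * p ^ k))"
      using Suc by (simp add: mult_ac)
    also have "\<dots> = V 0 * (R1 (Suc k) * R2 (Suc k)) * (?a * ?b)"
      unfolding R1[symmetric] R2[symmetric] by (simp add: mult_ac)
    finally show ?case using nz(1)[of k] nz(2)[of k m] by (metis mult_right_cancel mult_eq_0_iff)
  qed simp
  have f: "(\<Prod>i<m. u k - (p ^ Suc i + q / p ^ Suc i)) = R1 k * R2 k / (p ^ k) ^ m" for k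
  proof -
    have "u k - (p ^ Suc i + q / p ^ Suc i) = (1 - p ^ (k + Suc i)) * (1 - q * p ^ k / p ^ Suc i) / p ^ k" for i
    proof -
      have "1 / a + q * a - (b + q / b) = (1 - a * b) * (1 - q * a / b) / a" if "a \<noteq> 0" "b \<noteq> 0" for a b
        using that by (simp add: field_simps)
      from this[of "p ^ k" "p ^ Suc i"] show ?thesis using p by (simp add: u_def power_add)
    qed
    thus ?thesis unfolding R1_def R2_def by (simp add: prod_dividef prod.distrib)
  qed
  have "wpoly N q p 1 1 k * wpoly N q p 1 x k
    = V 0 / (R1 0 * R2 0) * (q / p) ^ k * (\<Prod>i<m. u k - (p ^ Suc i + q / p ^ Suc i))" if "k \<le> N" for k
  proof -
    have "V k = V 0 * (R1 k * R2 k) / (x ^ k * (R1 0 * R2 0))"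
      using main[OF that] R0 x by (simp add: field_simps)
    also have "x = p ^ Suc m / q" using x q0 by (simp add: field_simps)
    also have "V 0 * (R1 k * R2 k) / ((p ^ Suc m / q) ^ k * (R1 0 * R2 0))
      = V 0 / (R1 0 * R2 0) * (q / p) ^ k * (R1 k * R2 k / (p ^ k) ^ m)"
      using p q0 R0 by (simp add: field_simps flip: power_mult)
    finally show ?thesis unfolding f V_def .
  qed
  thus ?thesis using that by blast
qed

text \<open>The \<open>M\<close> pairs of an undeformed factor and one deformed to
  \<open>q x\<close> become the \<open>M\<close>-th power of a polynomial in the node; what remains
  becomes the Lagrange weights. The hypothesis \<open>inj\<close> excludes roots of unity and so
  keeps the nodes apart.\<close>

lemma defsum_eq_0_generic:
  fixes q :: "'a::field"
  assumes M: "M \<ge> 1" and N: "N + Suc m = n" "n + 1 = (2 * M + 2) * Suc m"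
    and q0: "q \<noteq> 0" and inj: "\<And>i j. q ^ i = q ^ j \<Longrightarrow> i = j"
  shows "defsum M N q (q ^ n) = 0"
proof -
  define d where "d = 2 * M + 2"
  define p where "p = q ^ d"
  define x where "x = q ^ n"
  define z where "z = (M + 1) * (2 * M - 1)"
  define u where "u k = 1 / p ^ k + q * p ^ k" for k
  have p0: "p \<noteq> 0" using q0 by (simp add: p_def)
  have p1: "p ^ i \<noteq> 1" if "i > 0" for i
  proof
    assume "p ^ i = 1"
    hence "q ^ (d * i) = q ^ 0" by (simp only: p_def power_mult power_0)
    hence "d * i = 0" by (rule inj)
    thus False using that by (simp add: d_def)
  qed
  have qp: "q * p ^ i \<noteq> p ^ j" for i j
  proof
    assume "q * p ^ i = p ^ j"
    hence "q ^ (d * i + 1) = q ^ (d * j)" by (simp add: p_def power_mult)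
    hence "d * i + 1 = d * j" by (rule inj)
    hence "even (d * i + 1) \<longleftrightarrow> even (d * j)" by simp
    thus False by (simp add: d_def)
  qed
  have px: "q * x = p ^ Suc m"
    using N(2) unfolding x_def p_def d_def power_mult[symmetric] by (simp only: flip: power_Suc Suc_eq_plus1)
  \<comment> \<open>Makes the parameter \<open>q / x ^ (2 * M + 1)\<close> equal to
    \<open>1 / p ^ N\<close>, which terminates the sum at \<open>N\<close>.\<close>
  have nodd: "(2 * M + 1) * n = d * N + 1"
  proof -
    have "(2 * M + 1) * n + (n + 1) = d * (N + Suc m) + 1"
      unfolding N(1) by (simp add: d_def algebra_simps)
    also have "\<dots> = d * N + 1 + (n + 1)"
      unfolding N(2) by (simp only: d_def add_mult_distrib2 add_ac)
    finally show ?thesis by simp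
  qed
  have xp: "x ^ (2 * M + 1) = q * p ^ N"
    using nodd unfolding x_def p_def power_mult[symmetric] by (simp add: mult.commute)
  have u_inj: "inj_on u {..N}"
  proof (rule linorder_inj_onI')
    fix i j :: nat assume "i < j"
    then obtain l where l: "j = i + Suc l" using less_iff_Suc_add by auto
    have "u j - u i = (1 - p ^ Suc l) * (1 - q * p ^ (i + j)) / p ^ j"
      unfolding u_def using node_diff[OF p0, of i j q] by (simp add: l add_ac)
    moreover have "1 - p ^ Suc l \<noteq> 0" using p1[of "Suc l"] by simp
    moreover have "1 - q * p ^ (i + j) \<noteq> 0" using qp[of "i + j" 0] by auto
    ultimately show "u i \<noteq> u j" using p0 by auto
  qed
  define g where "g = (\<Prod>i<m. [:- (p ^ Suc i + q / p ^ Suc i), 1:])"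
  have g: "poly g y = (\<Prod>i<m. y - (p ^ Suc i + q / p ^ Suc i))" for y
    by (simp add: g_def poly_prod algebra_simps)
  have x0: "x \<noteq> 0" using q0 by (simp add: x_def)
  obtain C where C: "\<And>k. k \<le> N \<Longrightarrow> wpoly N q p 1 1 k * wpoly N q p 1 x k
    = C * (q / p) ^ k * poly g (u k)"
    using wpoly_pair_eq[OF p0 px x0 p1 qp, of N] unfolding g u_def by blast
  define W where "W k = (1 - q * p ^ (2 * k)) * wpoly N q p 1 1 k * wpoly N q p (q * p ^ N) 1 k / q ^ k" for k
  define K where "K = (-1) ^ N * (\<Prod>j<N. 1 - p ^ Suc j) ^ 2 * (\<Prod>j<2 * N + 1. 1 - q * p ^ j) / (\<Prod>j<N. p ^ Suc j)"
  have W: "W k * (\<Prod>j\<in>{..N} - {k}. u k - u j) = K" if "k \<le> N" for k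
  proof -
    have "(1 - q * p ^ (2 * k)) * wpoly N q p 1 1 k * wpoly N q p (q * p ^ N) 1 k
        * (\<Prod>j\<in>{..N} - {k}. u k - u j) = K * q ^ k"
      using node_prod_const[OF p0 that, of q] unfolding K_def u_def .
    thus ?thesis
      unfolding W_def times_divide_eq_left by (metis q0 nonzero_mult_div_cancel_right power_not_zero)
  qed
  have "degree g \<le> m"
    unfolding g_def by (rule order.trans[OF degree_prod_sum_le]) auto
  hence "degree (g ^ M) \<le> m * M"
    by (metis degree_power_le mult_le_mono1 order.trans)
  \<comment> \<open>The hypotheses give \<open>N = 2 * M * m + 2 * M + m\<close>.\<close>
  also have "m * M < N" using N M by (simp add: algebra_simps)
  finally have sum0: "(\<Sum>k\<le>N. W k * poly (g ^ M) (u k)) = 0"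
    by (intro lagrange_weights_sum_eq_0[OF u_inj _ W])
  \<comment> \<open>The \<open>M\<close> pairs contribute \<open>(q / p) ^ (M * k)\<close>; with
    \<open>q ^ (z * k)\<close> this leaves \<open>1 / q ^ k\<close>, the correction built into
    \<open>W\<close>.\<close>
  have qz: "(q / p) ^ M * q ^ z = 1 / q"
  proof -
    obtain M' where M': "M = Suc M'" using M by (cases M) auto
    have "d * M = M + z + 1" by (simp add: d_def z_def M' algebra_simps)
    hence "p ^ M = q ^ M * q ^ z * q" by (simp only: p_def power_mult[symmetric] power_add power_one_right)
    thus ?thesis using q0 p0 by (simp add: power_divide field_simps)
  qed
  have "defsum M N q x = (\<Sum>k\<le>N. C ^ M * (W k * poly (g ^ M) (u k)))"
    unfolding defsum_def Let_def d_def[symmetric] p_def[symmetric] z_def[symmetric] xp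
  proof (rule sum.cong)
    fix k assume "k \<in> {..N}"
    hence k: "k \<le> N" by simp
    have "(1 - q * p ^ (2 * k)) * wpoly N q p 1 1 k ^ (M + 1) * wpoly N q p (q * p ^ N) 1 k
       * wpoly N q p 1 x k ^ M * q ^ (z * k) =
       (1 - q * p ^ (2 * k)) * wpoly N q p 1 1 k * wpoly N q p (q * p ^ N) 1 k
       * (wpoly N q p 1 1 k * wpoly N q p 1 x k) ^ M * q ^ (z * k)"
      by (simp only: power_add power_one_right power_mult_distrib mult_ac)
    also have "\<dots> = (1 - q * p ^ (2 * k)) * wpoly N q p 1 1 k * wpoly N q p (q * p ^ N) 1 k
       * C ^ M * poly (g ^ M) (u k) * ((q / p) ^ M * q ^ z) ^ k"
      unfolding C[OF k] power_mult_distrib poly_power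
      by (simp only: mult_ac flip: power_mult)
    also have "\<dots> = C ^ M * (W k * poly (g ^ M) (u k))"
      unfolding qz W_def by (simp add: power_divide)
    finally show "(1 - q * p ^ (2 * k)) * wpoly N q p 1 1 k ^ (M + 1) * wpoly N q p (q * p ^ N) 1 k
       * wpoly N q p 1 x k ^ M * q ^ (z * k) = C ^ M * (W k * poly (g ^ M) (u k))" .
  qed simp
  also have "\<dots> = 0" using sum0 by (simp flip: sum_distrib_left)
  finally show ?thesis unfolding x_def .
qed

section \<open>Double zeros from bivariate polynomials: \<open>q\<close> is the inner variable, the
  deformation the outer one\<close>

lemma poly_poly_map:
  fixes P :: "'a::comm_ring_1 poly poly"
  shows "poly (poly P a) z = poly (map_poly (\<lambda>c. poly c z) P) (poly a z)"
  by (induction P) (simp_all add: map_poly_pCons)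

text \<open>Specialising the inner variable to \<open>z\<close> leaves a polynomial in the outer
  variable with every number as a root, hence zero; so each coefficient is divisible by the linear
  factor.\<close>

lemma linear_dvd_if_vanishes:
  fixes P :: "complex poly poly"
  assumes "\<And>x. poly (poly P [:x:]) z = 0"
  shows "[:[:- z, 1:]:] dvd P"
proof -
  have "\<forall>x. poly (map_poly (\<lambda>c. poly c z) P) x = 0"
    using assms by (simp add: poly_poly_map)
  hence "map_poly (\<lambda>c. poly c z) P = 0" using poly_all_0_iff_0 by blast
  hence "poly (coeff P i) z = 0" for i
    by (metis coeff_0 coeff_map_poly poly_0)
  thus ?thesis by (simp add: const_poly_dvd_iff poly_eq_0_iff_dvd)
qed

text \<open>Divide \<open>P\<close> by the linear factor: the quotient still vanishes along the
  curve \<open>a\<close>, which meets \<open>b\<close> at \<open>z\<close>. Hence the quotient along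
  \<open>b\<close> vanishes at \<open>z\<close>, which supplies the second factor.\<close>

lemma square_dvd_if_vanishes:
  fixes P :: "complex poly poly"
  assumes z: "\<And>x. poly (poly P [:x:]) z = 0" and a: "poly P a = 0" and ab: "poly a z = poly b z"
  shows "[:- z, 1:] ^ 2 dvd poly P b"
proof -
  obtain Q where Q: "P = [:[:- z, 1:]:] * Q"
    using linear_dvd_if_vanishes[OF z] by (elim dvdE)
  have "[:- z, 1:] * poly Q a = 0" using a unfolding Q poly_mult by simp
  moreover have "[:- z, 1:] \<noteq> 0" by simp
  ultimately have "poly Q a = 0" using mult_eq_0_iff by blast
  hence "poly (poly Q b) z = 0" using ab by (metis poly_0 poly_poly_map)
  hence "[:- z, 1:] dvd poly Q b" by (simp add: poly_eq_0_iff_dvd)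
  hence "[:- z, 1:] * [:- z, 1:] dvd [:- z, 1:] * poly Q b" by (rule mult_dvd_mono[OF dvd_refl])
  thus ?thesis by (simp add: Q power2_eq_square)
qed

section \<open>Transport along ring homomorphisms\<close>

text \<open>Moves the polymorphic sums along evaluation of polynomials, the embedding into fractions
  and the coefficient map out of the rationals.\<close>

locale ring_map =
  fixes h :: "'a::comm_ring_1 \<Rightarrow> 'b::comm_ring_1"
  assumes add: "h (a + b) = h a + h b" and mult: "h (a * b) = h a * h b" and one: "h 1 = 1"
begin

lemma zero: "h 0 = 0"
  using add[of 0 0] by simp

lemma diff: "h (a - b) = h a - h b"
  using add[of "a - b" b] by simp

lemma power: "h (a ^ n) = h a ^ n"
  by (induction n) (simp_all add: one mult)

lemma prod: "h (prod f A) = (\<Prod>i\<in>A. h (f i))"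
  by (induction A rule: infinite_finite_induct) (simp_all add: one mult)

lemma sum: "h (sum f A) = (\<Sum>i\<in>A. h (f i))"
  by (induction A rule: infinite_finite_induct) (simp_all add: zero add)

lemmas hom = zero one add mult diff power prod sum

lemma wpoly: "h (wpoly N q p x y k) = wpoly N (h q) (h p) (h x) (h y) k"
  by (simp add: wpoly_def hom)

lemma defsum: "h (defsum M N q x) = defsum M N (h q) (h x)"
  by (simp add: defsum_def Let_def hom wpoly del: power_Suc)

end

lemma ring_map_poly: "ring_map (\<lambda>p. poly p (z::'a::comm_ring_1))"
  by unfold_locales simp_all

lemma ring_map_to_fract: "ring_map (to_fract :: 'a::idom \<Rightarrow> 'a fract)"
  by unfold_locales simp_all

lemma ring_map_of_rat_poly: "ring_map (map_poly of_rat :: rat poly \<Rightarrow> 'a::field_char_0 poly)"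
proof
  fix a b :: "rat poly"
  show "map_poly of_rat (a + b) = map_poly of_rat a + (map_poly of_rat b :: 'a poly)"
    by (rule poly_eqI) (simp add: coeff_map_poly of_rat_add)
  show "map_poly of_rat (a * b) = map_poly of_rat a * (map_poly of_rat b :: 'a poly)"
    by (rule poly_eqI) (simp add: coeff_map_poly coeff_mult of_rat_sum of_rat_mult)
qed simp

section \<open>Clearing denominators and the congruence in lowest terms\<close>

text \<open>The sum of the theorem over the common denominator \<open>denom\<close>, with
  \<open>z\<close> standing for \<open>d (d - 3) / 2\<close>.\<close>

definition numer :: "nat \<Rightarrow> nat \<Rightarrow> nat \<Rightarrow> 'a::comm_ring_1 \<Rightarrow> 'a" where
  "numer d z n q = (\<Sum>k<n. (1 - q ^ (2 * d * k + 1)) * qpoch q (q ^ d) k ^ d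
     * (\<Prod>j=k..<n - 1. 1 - (q ^ d) ^ Suc j) ^ d * q ^ (z * k))"

definition denom :: "nat \<Rightarrow> nat \<Rightarrow> 'a::comm_ring_1 \<Rightarrow> 'a" where
  "denom d n q = (1 - q) * qpoch (q ^ d) (q ^ d) (n - 1) ^ d"

lemma (in ring_map) numer: "h (numer d z n q) = numer d z n (h q)"
  by (simp add: numer_def qpoch_def hom del: power_Suc)

lemma (in ring_map) denom: "h (denom d n q) = denom d n (h q)"
  by (simp add: denom_def qpoch_def hom)

lemma sum_eq_numer_div_denom:
  fixes q :: "'a::field"
  assumes q: "\<And>i. i > 0 \<Longrightarrow> q ^ i \<noteq> 1" and d: "d > 0"
  shows "(\<Sum>k<n. (1 - q ^ (2 * d * k + 1)) / (1 - q) * qpoch q (q ^ d) k ^ d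
      / qpoch (q ^ d) (q ^ d) k ^ d * q ^ (z * k)) = numer d z n q / denom d n q"
  unfolding numer_def sum_divide_distrib
proof (rule sum.cong)
  fix k assume "k \<in> {..<n}"
  hence k: "k \<le> n - 1" by auto
  define R where "R = (\<Prod>j=k..<n - 1. 1 - (q ^ d) ^ Suc j)"
  define Q where "Q = qpoch (q ^ d) (q ^ d) k"
  have "qpoch (q ^ d) (q ^ d) (n - 1) = Q * R"
    using prod.atLeastLessThan_concat[of 0 k "n - 1" "\<lambda>j. 1 - (q ^ d) ^ Suc j"] k
    by (simp add: qpoch_def R_def Q_def atLeast0LessThan)
  hence den: "denom d n q = (1 - q) * (Q ^ d * R ^ d)"
    by (simp add: denom_def power_mult_distrib)
  have nz: "1 - (q ^ d) ^ Suc j \<noteq> 0" for j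
    using q[of "d * Suc j"] d by (simp only: power_mult) simp
  have "1 - q \<noteq> 0" "Q \<noteq> 0" "R \<noteq> 0"
    using q[of 1] nz by (auto simp: R_def Q_def qpoch_def prod_zero_iff)
  thus "(1 - q ^ (2 * d * k + 1)) / (1 - q) * qpoch q (q ^ d) k ^ d
      / qpoch (q ^ d) (q ^ d) k ^ d * q ^ (z * k) = (1 - q ^ (2 * d * k + 1)) * qpoch q (q ^ d) k ^ d
     * (\<Prod>j=k..<n - 1. 1 - (q ^ d) ^ Suc j) ^ d * q ^ (z * k) / denom d n q"
    unfolding den R_def[symmetric] Q_def[symmetric] by (simp add: field_simps del: power_Suc)
qed simp

text \<open>Any representation \<open>a / b\<close> will do: \<open>a * b' = a' * b\<close> shows
  that the reduced denominator divides \<open>b\<close>, and as \<open>b\<close> is nonzero at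
  \<open>z\<close>, the power passes from \<open>a\<close> to the reduced numerator. Linear factors
  at distinct points are coprime, so divisibility at each point suffices.\<close>

lemma ratfun_cong_zeroI:
  assumes x: "x = to_fract a / to_fract b"
    and b: "\<And>z. z \<in> Z \<Longrightarrow> poly (map_poly of_rat b) z \<noteq> 0"
    and a: "\<And>z. z \<in> Z \<Longrightarrow> [:- z, 1:] ^ m dvd map_poly of_rat a"
    and fin: "finite Z"
  shows "ratfun_cong_zero x ((\<Prod>z\<in>Z. [:- z, 1:]) ^ m)"
\<comment> \<open>For empty \<open>Z\<close> the modulus is 1 and \<open>b\<close> may be 0; a point
  of \<open>Z\<close> guarantees \<open>b \<noteq> 0\<close>.\<close>
proof (cases "Z = {}")
  case True
  thus ?thesis by (simp add: ratfun_cong_zero_def split: prod.splits)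
next
  case False
  interpret h: ring_map "map_poly of_rat :: rat poly \<Rightarrow> complex poly" by (rule ring_map_of_rat_poly)
  interpret f: ring_map "to_fract :: rat poly \<Rightarrow> rat poly fract" by (rule ring_map_to_fract)
  obtain a' b' where ab: "quot_of_fract x = (a', b')" by (cases "quot_of_fract x")
  have b0: "b \<noteq> 0" using b False by auto
  have "to_fract a / to_fract b = to_fract a' / to_fract b'" "b' \<noteq> 0" "coprime a' b'"
    using quot_to_fract_quot_of_fract[of x] snd_quot_of_fract_nonzero[of x] coprime_quot_of_fract[of x] ab x
    by (auto simp: quot_to_fract_def Fract_conv_to_fract)
  hence "to_fract (a * b') = to_fract (a' * b)"
    using b0 by (simp add: frac_eq_eq f.hom)
  hence eq: "a * b' = a' * b" by (simp only: to_fract_eq_iff)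
  have "b' dvd a' * b" by (simp flip: eq)
  hence "b' dvd b" using \<open>coprime a' b'\<close> by (simp add: coprime_commute coprime_dvd_mult_right_iff)
  hence b': "poly (map_poly of_rat b') z \<noteq> 0" if "z \<in> Z" for z
    using b[OF that] by (auto simp: h.hom elim!: dvdE)
  have cop: "coprime c [:- z, 1:]" if "poly c z \<noteq> 0" for c :: "complex poly" and z
  proof -
    have "prime_elem [:- z, 1:]"
      by (rule prime_elem_linear_field_poly) simp
    moreover have "\<not> [:- z, 1:] dvd c" using that by (simp add: poly_eq_0_iff_dvd)
    ultimately show ?thesis by (metis prime_elem_imp_coprime coprime_commute)
  qed
  have a': "[:- z, 1:] ^ m dvd map_poly of_rat a'" if "z \<in> Z" for z
  proof -
    have "[:- z, 1:] ^ m dvd map_poly of_rat (a' * b)"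
      using a[OF that] by (simp add: h.hom flip: eq)
    moreover have "coprime ([:- z, 1:] ^ m) (map_poly of_rat b)"
      using cop[OF b[OF that]] by (simp add: coprime_commute)
    ultimately show ?thesis by (simp add: h.hom coprime_dvd_mult_left_iff)
  qed
  have "(\<Prod>z\<in>Z. [:- z, 1:] ^ m) dvd map_poly of_rat a'"
    using fin a'
  proof (induction Z rule: finite_induct)
    case (insert z Z)
    have "coprime ([:- w, 1:] ^ m) ([:- z, 1:] ^ m)" if "w \<in> Z" for w
      using cop[of "[:- w, 1:]" z] insert.hyps that by auto
    hence "coprime ([:- z, 1:] ^ m) (\<Prod>z\<in>Z. [:- z, 1:] ^ m)"
      by (intro prod_coprime_right) (simp add: coprime_commute)
    thus ?case using insert by (simp add: divides_mult)
  qed simp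
  moreover have "coprime (map_poly of_rat b') ((\<Prod>z\<in>Z. [:- z, 1:]) ^ m)"
    using cop b' by (intro coprime_power_right_iff[THEN iffD2] disjI1 prod_coprime_right) auto
  ultimately show ?thesis
    by (simp add: ratfun_cong_zero_def ab prod_power_distrib)
qed

section \<open>Double zeros at the roots of unity\<close>

text \<open>Both vanishing results enter here: the curves \<open>x = q ^ n\<close> and
  \<open>x = 1\<close> meet at \<open>q = z\<close> because \<open>z ^ n = 1\<close>.\<close>

lemma square_dvd_defsum:
  fixes z :: complex
  assumes M: "M \<ge> 1" and N: "N + Suc m = n" "n + 1 = (2 * M + 2) * Suc m" and z: "z ^ n = 1"
  shows "[:- z, 1:] ^ 2 dvd defsum M N [:0, 1:] 1"
proof -
  let ?X = "[:0, 1:] :: complex poly"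
  define P where "P = defsum M N [:?X:] [:0, 1:]"
  have P: "poly P a = defsum M N ?X a" for a
    unfolding P_def by (simp add: ring_map.defsum[OF ring_map_poly])
  have exp: "(2 * M + 2) * N + 1 = (2 * M + 1) * n"
  proof -
    have "(2 * M + 2) * N + 1 + (n + 1) = (2 * M + 2) * (N + Suc m) + 1"
      unfolding N(2) by (simp only: add_mult_distrib2 add_ac)
    also have "\<dots> = (2 * M + 1) * n + (n + 1)" unfolding N(1) by (simp add: algebra_simps)
    finally show ?thesis by simp
  qed
  have root: "z ^ ((2 * M + 2) * N + 1) = 1"
    unfolding exp by (subst mult.commute) (simp only: power_mult z power_one)
  have "[:- z, 1:] ^ 2 dvd poly P 1"
  proof (rule square_dvd_if_vanishes)
    show "poly (poly P [:x:]) z = 0" for x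
      unfolding P by (simp add: ring_map.defsum[OF ring_map_poly] defsum_eq_0_at_root[OF root M])
    show "poly (?X ^ n) z = poly 1 z" by (simp add: z)
    \<comment> \<open>Along \<open>x = q ^ n\<close> the sum is a polynomial in \<open>q\<close>, so
      it is enough to see it vanish at the integers \<open>b \<ge> 2\<close>: infinitely many, and
      no roots of unity.\<close>
    have "poly (poly P (?X ^ n)) (of_nat b) = 0" if b: "b \<ge> 2" for b
    proof -
      have "of_nat b ^ i = (of_nat b ^ j :: complex) \<Longrightarrow> i = j" for i j
        using b by (simp flip: of_nat_power)
      hence "defsum M N (of_nat b :: complex) (of_nat b ^ n) = 0"
        using b by (intro defsum_eq_0_generic[OF M N]) auto
      thus ?thesis
        unfolding P by (simp add: ring_map.defsum[OF ring_map_poly])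
    qed
    hence sub: "of_nat ` {2..} \<subseteq> {y. poly (poly P (?X ^ n)) y = 0}" by auto
    have "infinite (of_nat ` {2..} :: complex set)"
      by (subst finite_image_iff) (auto simp: inj_on_def infinite_Ici)
    thus "poly P (?X ^ n) = 0"
      using sub poly_roots_finite finite_subset by blast
  qed
  thus ?thesis unfolding P .
qed

text \<open>The terms with \<open>k \<le> N\<close> form a multiple of \<open>defsum\<close> at
  \<open>x = 1\<close>. For \<open>k > N\<close> the shifted factorial contains
  \<open>1 - q * (q ^ d) ^ N\<close>, which vanishes at \<open>z\<close> because
  \<open>d * N + 1\<close> is a multiple of \<open>n\<close>.\<close>

lemma square_dvd_numer:
  fixes z :: complex
  assumes M: "M \<ge> 1" and N: "N + Suc m = n" "n + 1 = (2 * M + 2) * Suc m" and z: "z ^ n = 1"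
  shows "[:- z, 1:] ^ 2 dvd numer (2 * M + 2) ((M + 1) * (2 * M - 1)) n [:0, 1:]"
proof -
  define q :: "complex poly" where "q = [:0, 1:]"
  define d where "d = 2 * M + 2"
  define e where "e = (M + 1) * (2 * M - 1)"
  define T where "T k = (1 - q ^ (2 * d * k + 1)) * qpoch q (q ^ d) k ^ d
     * (\<Prod>j=k..<n - 1. 1 - (q ^ d) ^ Suc j) ^ d * q ^ (e * k)" for k
  have q2: "q ^ (2 * d * k + 1) = q * (q ^ d) ^ (2 * k)" for k
    by (simp add: mult_ac flip: power_mult)
  have exp: "d * N + 1 = n * (2 * M + 1)"
  proof -
    have "d * N + 1 + (n + 1) = d * (N + Suc m) + 1"
      unfolding N(2) d_def by (simp only: add_mult_distrib2 add_ac)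
    also have "\<dots> = n * (2 * M + 1) + (n + 1)" unfolding N(1) by (simp add: d_def algebra_simps)
    finally show ?thesis by simp
  qed
  have big: "[:- z, 1:] ^ 2 dvd T k" if "k > N" for k
  proof -
    have "poly (1 - q * (q ^ d) ^ N) z = 0"
    proof -
      have "z * (z ^ d) ^ N = z ^ (d * N + 1)" by (simp add: power_mult)
      also have "\<dots> = 1" unfolding exp power_mult z by simp
      finally show ?thesis by (simp add: q_def)
    qed
    hence "[:- z, 1:] dvd 1 - q * (q ^ d) ^ N" by (simp only: poly_eq_0_iff_dvd)
    also have "\<dots> dvd qpoch q (q ^ d) k"
      unfolding qpoch_def using that by (intro dvd_prodI) auto
    finally have "[:- z, 1:] ^ d dvd qpoch q (q ^ d) k ^ d" by (rule dvd_power_same)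
    moreover have "[:- z, 1:] ^ 2 dvd [:- z, 1:] ^ d" by (rule le_imp_power_dvd) (simp add: d_def)
    ultimately have "[:- z, 1:] ^ 2 dvd qpoch q (q ^ d) k ^ d" by (rule dvd_trans[rotated])
    thus ?thesis unfolding T_def by (intro dvd_mult2 dvd_mult)
  qed
  \<comment> \<open>The cleared denominator factors beyond \<open>N\<close>, common to all terms
    with \<open>k \<le> N\<close> and absent from \<open>wpoly\<close>.\<close>
  define K where "K = (\<Prod>j=N..<n - 1. 1 - (q ^ d) ^ Suc j)"
  have small: "(\<Sum>k\<le>N. T k) = K ^ d * defsum M N q 1"
    unfolding defsum_def Let_def sum_distrib_left
  proof (rule sum.cong)
    fix k assume "k \<in> {..N}"
    hence k: "k \<le> N" by simp
    have "(\<Prod>j=k..<n - 1. 1 - (q ^ d) ^ Suc j) = (\<Prod>j=k..<N. 1 - (q ^ d) ^ Suc j) * K"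
      unfolding K_def using k N(1) by (intro prod.atLeastLessThan_concat[symmetric]) auto
    hence w: "qpoch q (q ^ d) k * (\<Prod>j=k..<n - 1. 1 - (q ^ d) ^ Suc j) = K * wpoly N q (q ^ d) 1 1 k"
      by (simp add: qpoch_def wpoly_def)
    have pow: "x ^ d = x ^ (M + 1) * x * x ^ M" for x :: "complex poly"
    proof -
      have "d = M + 1 + 1 + M" by (simp add: d_def)
      thus ?thesis by (simp only: power_add power_one_right)
    qed
    have "T k = (1 - q ^ (2 * d * k + 1)) * (qpoch q (q ^ d) k * (\<Prod>j=k..<n - 1. 1 - (q ^ d) ^ Suc j)) ^ d * q ^ (e * k)"
      unfolding T_def by (simp only: power_mult_distrib mult_ac)
    also have "\<dots> = K ^ d * ((1 - q * (q ^ d) ^ (2 * k)) * wpoly N q (q ^ d) 1 1 k ^ d * q ^ (e * k))"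
      unfolding w q2 by (simp only: power_mult_distrib mult_ac)
    finally show "T k = K ^ d * ((1 - q * (q ^ (2 * M + 2)) ^ (2 * k)) * wpoly N q (q ^ (2 * M + 2)) 1 1 k ^ (M + 1)
       * wpoly N q (q ^ (2 * M + 2)) (1 ^ (2 * M + 1)) 1 k * wpoly N q (q ^ (2 * M + 2)) 1 1 k ^ M
       * q ^ ((M + 1) * (2 * M - 1) * k))"
      unfolding pow[of "wpoly N q (q ^ d) 1 1 k"] e_def[symmetric] d_def[symmetric] power_one
      by (simp only: mult.assoc)
  qed simp
  have "{..<n} = {..N} \<union> {N<..<n}" using N(1) by auto
  moreover have "sum T ({..N} \<union> {N<..<n}) = sum T {..N} + sum T {N<..<n}"
    by (rule sum.union_disjoint) auto
  ultimately have "(\<Sum>k<n. T k) = (\<Sum>k\<le>N. T k) + (\<Sum>k\<in>{N<..<n}. T k)"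
    by (rule ssubst)
  moreover have "[:- z, 1:] ^ 2 dvd (\<Sum>k\<le>N. T k)"
    unfolding small q_def using square_dvd_defsum[OF assms] by (rule dvd_mult)
  moreover have "[:- z, 1:] ^ 2 dvd (\<Sum>k\<in>{N<..<n}. T k)"
    by (rule dvd_sum) (use big in auto)
  ultimately have "[:- z, 1:] ^ 2 dvd (\<Sum>k<n. T k)"
    by (simp only: dvd_add)
  thus ?thesis
    unfolding numer_def T_def d_def e_def q_def .
qed

section \<open>Primitive roots of unity\<close>

lemma cis_power_eq_1_imp_dvd:
  assumes "coprime k n" "n > 0" "cis (2 * pi * real k / real n) ^ i = 1"
  shows "n dvd i"
proof -
  have "cos (real i * (2 * pi * real k / real n)) = 1"
    using assms(3) by (simp add: DeMoivre complex_eq_iff)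
  then obtain l :: int where "real i * (2 * pi * real k / real n) = real_of_int l * 2 * pi"
    unfolding cos_one_2pi_int by blast
  hence "real i * real k = real_of_int l * real n"
    using assms(2) by (simp add: field_simps)
  hence "int (i * k) = l * int n"
    unfolding of_nat_mult by (metis of_int_eq_iff of_int_mult of_int_of_nat_eq)
  hence "n dvd i * k" by (metis dvd_triv_right int_dvd_int_iff)
  thus ?thesis using assms(1) by (metis coprime_commute coprime_dvd_mult_left_iff)
qed

text \<open>As \<open>d\<close> is coprime to \<open>n\<close>, no exponent \<open>d * Suc j\<close>
  with \<open>Suc j < n\<close> is a multiple of \<open>n\<close>.\<close>

lemma denom_nonzero_at_primitive_root:
  fixes z :: complex
  assumes n: "n > 1" and cop: "coprime d n" and z: "\<And>i. z ^ i = 1 \<Longrightarrow> n dvd i"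
  shows "denom d n z \<noteq> 0"
proof -
  have "z ^ 1 \<noteq> 1" using z[of 1] n by auto
  moreover have "1 - z ^ d * (z ^ d) ^ j \<noteq> 0" if "j < n - 1" for j
  proof
    assume "1 - z ^ d * (z ^ d) ^ j = 0"
    hence "z ^ (d * Suc j) = 1" by (simp only: power_mult power_Suc) simp
    hence "n dvd d * Suc j" by (rule z)
    hence "n dvd Suc j" using cop by (metis coprime_commute coprime_dvd_mult_right_iff)
    hence "n \<le> Suc j" by (rule dvd_imp_le) simp
    thus False using that by simp
  qed
  ultimately show ?thesis
    by (auto simp: denom_def qpoch_def prod_zero_iff)
qed

section \<open>Assembling the congruence from the primitive roots\<close>

theorem theorem2:
  fixes d n :: nat
  assumes "even d" and "d \<ge> 4" and "n > 0" and "[int n = -1] (mod int d)"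
  shows "ratfun_cong_zero
           (\<Sum>k<n. qint (2 * d * k + 1)
                    * (qpoch qvar (qvar ^ d) k) ^ d / (qpoch (qvar ^ d) (qvar ^ d) k) ^ d
                    * qvar ^ (d * (d - 3) * k div 2))
           ((cyclotomic n) ^ 2)"
proof -
  obtain M where d: "d = 2 * M + 2" and M: "M \<ge> 1"
  proof -
    obtain b where "d = 2 * b" using assms(1) by (elim evenE)
    with assms(2) that[of "b - 1"] show ?thesis by auto
  qed
  have "int d dvd int (n + 1)" using assms(4) by (simp add: cong_iff_dvd_diff add.commute)
  hence "d dvd n + 1" by (simp only: int_dvd_int_iff)
  then obtain c where c: "n + 1 = d * c" by (elim dvdE)
  then obtain m where m: "n + 1 = (2 * M + 2) * Suc m" unfolding d by (cases c) auto
  have mn: "Suc m \<le> n" using m by simp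
  define N where "N = n - Suc m"
  have N: "N + Suc m = n" using mn by (simp add: N_def)
  have n: "n > 1" using m M by (cases n) auto
  have cop: "coprime d n"
  proof (rule coprimeI)
    fix a assume "a dvd d" "a dvd n"
    hence "a dvd n + 1" "a dvd n" using c by auto
    thus "is_unit a" using dvd_add_right_iff by blast
  qed
  define e where "e = (M + 1) * (2 * M - 1)"
  \<comment> \<open>The division is exact because \<open>d\<close> is even.\<close>
  have e: "d * (d - 3) * k div 2 = e * k" for k
  proof -
    have "d - 3 = 2 * M - 1" using d by simp
    hence "d * (d - 3) * k = 2 * (e * k)" by (simp add: d e_def)
    thus ?thesis by (simp only: nonzero_mult_div_cancel_left)
  qed
  define q where "q = ([:0, 1:] :: rat poly)"
  have qvar: "qvar = to_fract q" by (simp add: qvar_def q_def)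
  \<comment> \<open>A positive power of the indeterminate has constant term 0.\<close>
  have gen: "qvar ^ i \<noteq> 1" if "i > 0" for i
  proof
    assume "qvar ^ i = 1"
    hence "to_fract (q ^ i) = to_fract 1" by (simp add: qvar ring_map.hom[OF ring_map_to_fract])
    hence "q ^ i = 1" by (simp only: to_fract_eq_iff)
    hence "poly (q ^ i) 0 = 1" by simp
    thus False using that by (simp add: q_def zero_power)
  qed
  have S: "(\<Sum>k<n. qint (2 * d * k + 1)
        * (qpoch qvar (qvar ^ d) k) ^ d / (qpoch (qvar ^ d) (qvar ^ d) k) ^ d
        * qvar ^ (d * (d - 3) * k div 2)) = to_fract (numer d e n q) / to_fract (denom d n q)"
    unfolding e qint_def qvar ring_map.numer[OF ring_map_to_fract] ring_map.denom[OF ring_map_to_fract]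
    by (rule sum_eq_numer_div_denom) (use gen d in \<open>auto simp: qvar\<close>)
  define I where "I = {k. k < n \<and> coprime k n}"
  define r where "r k = cis (2 * pi * real k / real n)" for k
  \<comment> \<open>Injectivity turns the product over indices in \<open>cyclotomic\<close> into one
    over the set of roots, the form that \<open>ratfun_cong_zeroI\<close> expects.\<close>
  have bij: "bij_betw r {..<n} {z. z ^ n = 1}"
    unfolding r_def using bij_betw_roots_unity n by simp
  have "inj_on r I"
    by (rule inj_on_subset[OF bij_betw_imp_inj_on[OF bij]]) (auto simp: I_def)
  hence cyc: "cyclotomic n = (\<Prod>z\<in>r ` I. [:- z, 1:])"
    by (simp add: cyclotomic_def prod.reindex I_def[symmetric] r_def[symmetric])
  have q': "map_poly of_rat q = ([:0, 1:] :: complex poly)" by (simp add: q_def map_poly_pCons)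
  show ?thesis
    unfolding S cyc
  proof (rule ratfun_cong_zeroI[OF refl])
    fix z assume "z \<in> r ` I"
    then obtain k where k: "k < n" "coprime k n" "z = r k" by (auto simp: I_def)
    have "z ^ i = 1 \<Longrightarrow> n dvd i" for i
      using cis_power_eq_1_imp_dvd[OF k(2)] n by (simp add: k(3) r_def)
    hence "denom d n z \<noteq> 0" by (rule denom_nonzero_at_primitive_root[OF n cop])
    thus "poly (map_poly of_rat (denom d n q)) z \<noteq> 0"
      by (simp add: ring_map.denom[OF ring_map_of_rat_poly] ring_map.denom[OF ring_map_poly] q')
    have "z ^ n = 1" using bij_betw_apply[OF bij] k by auto
    thus "[:- z, 1:] ^ 2 dvd map_poly of_rat (numer d e n q)"
      using square_dvd_numer[OF M N m]
      by (simp add: ring_map.numer[OF ring_map_of_rat_poly] q' d e_def)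
  next
    show "finite (r ` I)" by (simp add: I_def)
  qed
qed

end
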